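(* Let $\Gamma$ be a finite, simple, connected cubic graph and $G\leq\mathrm{Aut}(\Gamma)$ vertex-transitive such that $(\Gamma,G)$ is locally-$\mathbb Z_2^{[3]}$ and not degenerate. Let $\mathrm M(\Gamma,G)$ and $\mathcal C(\Gamma,G)$ be as defined below, and let $\Gamma'=\mathrm S(\mathrm M(\Gamma,G),\mathcal C(\Gamma,G))$. Then $\Gamma'\cong\Gamma$.
   Context: $(\Gamma,G)$ is locally-$\mathbb Z_2^{[3]}$ if for a vertex $v$ the group induced by $G_v$ on the neighbourhood $\Gamma(v)$ is permutation isomorphic to the group of order $2$ acting on $3$ points. Then each vertex $u$ has a unique neighbour $u'$ fixed by $G_u$; $\mathcal T=\{\{u,u'\}:u\in\mathrm V(\Gamma)\}$ is a $G$-edge-orbit forming a perfect matching, and the remaining edges form a $G$-edge-orbit $\mathcal R$ inducing a disjoint union of cycles $C_1,\dots,C_n$. The pair is degenerate if for some $\{u,u'\},\{v,v'\}\in\mathcal T$ there is more than one edge of $\Gamma$ between these two sets. $\mathrm M(\Gamma,G)$ has vertex-set $\mathcal T$, with $\{u,u'\}\sim\{v,v'\}$ iff some member of one is adjacent in $\Gamma$ to some member of the other; with $\iota(\{u,v\})=\{\{u,u'\},\{v,v'\}\}$ for $\{u,v\}\in\mathcal R$, set $\mathcal C(\Gamma,G)=\{\iota(C_1),\dots,\iota(C_n)\}$, a set of cycles of $\mathrm M(\Gamma,G)$. For a graph $\Lambda$ and a set $\mathcal C$ of cycles of $\Lambda$ decomposing its edges, $\mathrm S(\Lambda,\mathcal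 C)$ is the graph whose vertices are the pairs $(v,C)$ with $v\in\mathrm V(\Lambda)$, $C\in\mathcal C$ and $v$ on $C$, where $(v_1,C_1)\sim(v_2,C_2)$ iff either $C_1\neq C_2$ and $v_1=v_2$, or $C_1=C_2$ and $\{v_1,v_2\}$ is an edge of $C_1$. *)

theory Defs
  imports
    "HOL-Algebra.Group_Action"
    "HOL-Combinatorics.Transposition"
    "Graph_Theory.Digraph_Isomorphism"
begin

text \<open>
  A finite simple graph is a \<^locale>\<open>pair_graph\<close>: a finite set of vertices with an irreflexive
  symmetric set of arcs, each edge giving two opposite arcs. Since perfect matchings, edge-orbits
  and cycles are families of unordered edges, edges also appear below as two-element sets.
\<close>

definition nbrs :: "'a pair_pre_digraph \<Rightarrow> 'a \<Rightarrow> 'a set" where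
  "nbrs \<Gamma> v = {w. (v, w) \<in> parcs \<Gamma>}"

definition edge_set :: "('a, 'b) pre_digraph \<Rightarrow> 'a set set" where
  "edge_set \<Gamma> = {{tail \<Gamma> a, head \<Gamma> a} | a. a \<in> arcs \<Gamma>}"

definition edge_induced :: "'a set set \<Rightarrow> 'a pair_pre_digraph" where
  "edge_induced E = \<lparr> pverts = \<Union>E, parcs = {(u, v). {u, v} \<in> E} \<rparr>"

definition cubic :: "'a pair_pre_digraph \<Rightarrow> bool" where
  "cubic \<Gamma> \<longleftrightarrow> (\<forall>v \<in> pverts \<Gamma>. out_degree \<Gamma> v = 3)"

text \<open>
  As in \<^const>\<open>BijGroup\<close>, permutations of a set are extensional functions
  (\<^const>\<open>undefined\<close> outside the set), so that each permutation is one function.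
\<close>

definition aut_group :: "'a pair_pre_digraph \<Rightarrow> ('a \<Rightarrow> 'a) monoid" where
  "aut_group \<Gamma> = BijGroup (pverts \<Gamma>)
     \<lparr> carrier := {f \<in> Bij (pverts \<Gamma>). \<forall>u \<in> pverts \<Gamma>. \<forall>v \<in> pverts \<Gamma>.
                     (f u, f v) \<in> parcs \<Gamma> \<longleftrightarrow> (u, v) \<in> parcs \<Gamma>} \<rparr>"

definition vertex_transitive :: "'a pair_pre_digraph \<Rightarrow> ('a \<Rightarrow> 'a) set \<Rightarrow> bool" where
  "vertex_transitive \<Gamma> G \<longleftrightarrow> transitive_action (aut_group \<Gamma> \<lparr>carrier := G\<rparr>) (pverts \<Gamma>) (\<lambda>g. g)"

definition vertex_stabilizer :: "'a pair_pre_digraph \<Rightarrow> ('a \<Rightarrow> 'a) set \<Rightarrow> 'a \<Rightarrow> ('a \<Rightarrow> 'a) set" where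
  "vertex_stabilizer \<Gamma> G v = stabilizer (aut_group \<Gamma> \<lparr>carrier := G\<rparr>) (\<lambda>g. g) v"

definition local_group :: "'a pair_pre_digraph \<Rightarrow> ('a \<Rightarrow> 'a) set \<Rightarrow> 'a \<Rightarrow> ('a \<Rightarrow> 'a) set" where
  "local_group \<Gamma> G v = (\<lambda>g. restrict g (nbrs \<Gamma> v)) ` vertex_stabilizer \<Gamma> G v"

text \<open>
  Permutation isomorphism of the permutation groups \<open>H\<close> on \<open>A\<close> and \<open>K\<close> on \<open>B\<close>: a bijection
  between the sets and a group isomorphism intertwining the two actions.
\<close>

definition perm_isomorphic ::
    "'a set \<Rightarrow> ('a \<Rightarrow> 'a) set \<Rightarrow> 'b set \<Rightarrow> ('b \<Rightarrow> 'b) set \<Rightarrow> bool" where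
  "perm_isomorphic A H B K \<longleftrightarrow>
     (\<exists>\<beta> \<phi>. bij_betw \<beta> A B \<and>
            \<phi> \<in> iso (BijGroup A \<lparr>carrier := H\<rparr>) (BijGroup B \<lparr>carrier := K\<rparr>) \<and>
            (\<forall>h \<in> H. \<forall>a \<in> A. \<beta> (h a) = \<phi> h (\<beta> a)))"

definition Z2_on_3 :: "(nat \<Rightarrow> nat) set" where
  "Z2_on_3 = {\<lambda>i \<in> {0, 1, 2}. i, \<lambda>i \<in> {0, 1, 2}. transpose 0 1 i}"

definition locally_Z2_3 :: "'a pair_pre_digraph \<Rightarrow> ('a \<Rightarrow> 'a) set \<Rightarrow> bool" where
  "locally_Z2_3 \<Gamma> G \<longleftrightarrow>
     (\<forall>v \<in> pverts \<Gamma>. perm_isomorphic (nbrs \<Gamma> v) (local_group \<Gamma> G v) {0, 1, 2} Z2_on_3)"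

text \<open>\<open>partner \<Gamma> G u\<close> is the neighbour \<open>u'\<close> of \<open>u\<close> fixed by the stabilizer of \<open>u\<close>.\<close>

definition partner :: "'a pair_pre_digraph \<Rightarrow> ('a \<Rightarrow> 'a) set \<Rightarrow> 'a \<Rightarrow> 'a" where
  "partner \<Gamma> G u = (THE w. w \<in> nbrs \<Gamma> u \<and> (\<forall>g \<in> vertex_stabilizer \<Gamma> G u. g w = w))"

definition T_edges :: "'a pair_pre_digraph \<Rightarrow> ('a \<Rightarrow> 'a) set \<Rightarrow> 'a set set" where
  "T_edges \<Gamma> G = {{u, partner \<Gamma> G u} | u. u \<in> pverts \<Gamma>}"

definition R_edges :: "'a pair_pre_digraph \<Rightarrow> ('a \<Rightarrow> 'a) set \<Rightarrow> 'a set set" where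
  "R_edges \<Gamma> G = edge_set \<Gamma> - T_edges \<Gamma> G"

definition degenerate :: "'a pair_pre_digraph \<Rightarrow> ('a \<Rightarrow> 'a) set \<Rightarrow> bool" where
  "degenerate \<Gamma> G \<longleftrightarrow>
     (\<exists>s \<in> T_edges \<Gamma> G. \<exists>t \<in> T_edges \<Gamma> G.
        card {e \<in> edge_set \<Gamma>. \<exists>x \<in> s. \<exists>y \<in> t. e = {x, y}} > 1)"

text \<open>The condition \<open>s \<noteq> t\<close> keeps the graph loopless: the two ends of each \<open>\<T>\<close>-edge are adjacent.\<close>

definition merge_graph :: "'a pair_pre_digraph \<Rightarrow> ('a \<Rightarrow> 'a) set \<Rightarrow> 'a set pair_pre_digraph" where
  "merge_graph \<Gamma> G =
     \<lparr> pverts = T_edges \<Gamma> G,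
       parcs = {(s, t). s \<in> T_edges \<Gamma> G \<and> t \<in> T_edges \<Gamma> G \<and> s \<noteq> t \<and>
                  (\<exists>x \<in> s. \<exists>y \<in> t. (x, y) \<in> parcs \<Gamma>)} \<rparr>"

text \<open>
  A cycle of a graph is represented by its set of edges, so the vertices on \<open>C\<close> are \<open>\<Union>C\<close>.
  The cycles \<open>C\<^sub>1, \<dots>, C\<^sub>n\<close> induced by the \<open>\<R>\<close>-edges are the connected components of the
  subgraph these edges induce; for a symmetric digraph, \<^const>\<open>pre_digraph.sccs\<close> are the
  connected components.
\<close>

definition R_cycles :: "'a pair_pre_digraph \<Rightarrow> ('a \<Rightarrow> 'a) set \<Rightarrow> 'a set set set" where
  "R_cycles \<Gamma> G = edge_set ` pre_digraph.sccs (edge_induced (R_edges \<Gamma> G))"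

definition iota :: "'a pair_pre_digraph \<Rightarrow> ('a \<Rightarrow> 'a) set \<Rightarrow> 'a set \<Rightarrow> 'a set set" where
  "iota \<Gamma> G e = (\<lambda>u. {u, partner \<Gamma> G u}) ` e"

definition merge_cycles :: "'a pair_pre_digraph \<Rightarrow> ('a \<Rightarrow> 'a) set \<Rightarrow> 'a set set set set" where
  "merge_cycles \<Gamma> G = {iota \<Gamma> G ` C | C. C \<in> R_cycles \<Gamma> G}"

definition split_verts :: "'a pair_pre_digraph \<Rightarrow> 'a set set set \<Rightarrow> ('a \<times> 'a set set) set" where
  "split_verts \<Lambda> \<C> = {(v, C). v \<in> pverts \<Lambda> \<and> C \<in> \<C> \<and> v \<in> \<Union>C}"

definition split_graph ::
    "'a pair_pre_digraph \<Rightarrow> 'a set set set \<Rightarrow> ('a \<times> 'a set set) pair_pre_digraph" where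
  "split_graph \<Lambda> \<C> =
     \<lparr> pverts = split_verts \<Lambda> \<C>,
       parcs = {((v1, C1), (v2, C2)). (v1, C1) \<in> split_verts \<Lambda> \<C> \<and> (v2, C2) \<in> split_verts \<Lambda> \<C> \<and>
                  (C1 \<noteq> C2 \<and> v1 = v2 \<or> C1 = C2 \<and> {v1, v2} \<in> C1)} \<rparr>"

end

theory Submission
  imports Defs
begin

text \<open>
  The isomorphism sends \<open>u\<close> to the pair of its matching edge \<open>{u, u'}\<close> and the image
  under \<open>\<iota>\<close> of the \<open>\<R>\<close>-cycle through \<open>u\<close>. Non-degeneracy makes \<open>\<iota>\<close> injective on
  \<open>\<R>\<close>, so distinct \<open>\<R>\<close>-cycles have disjoint images, and everything reduces to showing that
  \<open>u\<close> and \<open>u'\<close> lie on different \<open>\<R>\<close>-cycles. Since \<open>G\<close> is transitive on the arcs of \<open>\<R>\<close>,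
  some \<open>h \<in> G\<close> takes the arc \<open>(u, v)\<close> to the next arc of its cycle, whose vertices are then the
  \<open>h\<^sup>i u\<close>. If \<open>u' = h\<^sup>n u\<close>, then \<open>v' = (h u)' = h u' = h\<^sup>n v\<close>, so \<open>{u', v'}\<close> is a second edge
  between \<open>{u, u'}\<close> and \<open>{v, v'}\<close>, contradicting non-degeneracy.
\<close>

section \<open>Isomorphisms from vertex bijections\<close>

lemma pair_digraph_isoI:
  fixes \<Gamma> :: "'a pair_pre_digraph" and \<Delta> :: "'b pair_pre_digraph"
  assumes wf: "pair_wf_digraph \<Gamma>" "pair_wf_digraph \<Delta>"
    and bij: "bij_betw f (pverts \<Gamma>) (pverts \<Delta>)"
    and adj: "\<And>u v. \<lbrakk>u \<in> pverts \<Gamma>; v \<in> pverts \<Gamma>\<rbrakk> \<Longrightarrow>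
      (u, v) \<in> parcs \<Gamma> \<longleftrightarrow> (f u, f v) \<in> parcs \<Delta>"
  shows "digraph_iso \<Gamma> \<Delta>"
proof -
  interpret A: pair_wf_digraph \<Gamma> by (rule wf(1))
  interpret B: pair_wf_digraph \<Delta> by (rule wf(2))
  \<comment> \<open>An arc is the pair of its ends, so the vertex map forces the arc map
    \<open>map_prod f f\<close>.\<close>
  let ?f = "\<lparr>iso_verts = f, iso_arcs = map_prod f f, iso_head = snd, iso_tail = fst\<rparr>"
  have inj: "inj_on f (pverts \<Gamma>)" and im: "f ` pverts \<Gamma> = pverts \<Delta>"
    using bij by (auto simp: bij_betw_def)
  have sub: "parcs \<Gamma> \<subseteq> pverts \<Gamma> \<times> pverts \<Gamma>"
    using A.wellformed' by auto
  have "inj_on (map_prod f f) (parcs \<Gamma>)"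
    using map_prod_inj_on[OF inj inj] sub by (rule inj_on_subset)
  then have "pre_digraph.digraph_isomorphism \<Gamma> ?f"
    using inj by (simp add: pre_digraph.digraph_isomorphism_def A.wf_digraph_axioms)
  moreover have "parcs \<Delta> = map_prod f f ` parcs \<Gamma>"
  proof (intro Set.set_eqI iffI)
    fix e assume e: "e \<in> parcs \<Delta>"
    obtain x y where xy: "e = (x, y)" by fastforce
    then have "x \<in> f ` pverts \<Gamma>" "y \<in> f ` pverts \<Gamma>"
      using e im B.wellformed' by auto
    then show "e \<in> map_prod f f ` parcs \<Gamma>"
      using e xy adj by force
  qed (use sub adj in auto)
  then have "with_proj \<Delta> = app_iso ?f \<Gamma>"
    using im by (simp add: app_iso_def with_proj_def)
  ultimately show ?thesis
    unfolding digraph_iso_def by blast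
qed

section \<open>The action of \<open>G\<close> on vertices and arcs\<close>

locale locally_Z2_3_pair = pair_graph \<Gamma> for \<Gamma> :: "'a pair_pre_digraph" +
  fixes G :: "('a \<Rightarrow> 'a) set"
  assumes subgroup: "subgroup G (aut_group \<Gamma>)"
    and transitive: "vertex_transitive \<Gamma> G"
    and locally: "locally_Z2_3 \<Gamma> G"
begin

abbreviation "V \<equiv> pverts \<Gamma>"
abbreviation "E \<equiv> parcs \<Gamma>"
abbreviation "N \<equiv> nbrs \<Gamma>"
abbreviation "p \<equiv> partner \<Gamma> G"

lemma arc_sym: "(u, v) \<in> E \<longleftrightarrow> (v, u) \<in> E"
  using pair_sym_arcs unfolding symmetric_def sym_def by auto

lemma arc_irrefl: "(u, u) \<notin> E"
  using pair_no_loops by force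

lemma nbrs_iff: "w \<in> N u \<longleftrightarrow> (u, w) \<in> E"
  by (simp add: nbrs_def)

lemma G_bij: "g \<in> G \<Longrightarrow> bij_betw g V V"
  using subgroup.subset[OF subgroup] by (auto simp: aut_group_def Bij_def)

lemma G_closed: "\<lbrakk>g \<in> G; u \<in> V\<rbrakk> \<Longrightarrow> g u \<in> V"
  using G_bij bij_betwE by fastforce

lemma G_inj: "\<lbrakk>g \<in> G; u \<in> V; v \<in> V\<rbrakk> \<Longrightarrow> g u = g v \<longleftrightarrow> u = v"
  using G_bij by (meson bij_betw_imp_inj_on inj_on_eq_iff)

lemma G_adj: "\<lbrakk>g \<in> G; u \<in> V; v \<in> V\<rbrakk> \<Longrightarrow> (g u, g v) \<in> E \<longleftrightarrow> (u, v) \<in> E"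
  using subgroup.subset[OF subgroup] by (auto simp: aut_group_def)

lemma G_compose:
  assumes "g \<in> G" "h \<in> G"
  shows "compose V g h \<in> G"
proof -
  have "g \<in> Bij V" "h \<in> Bij V"
    using assms subgroup.subset[OF subgroup] by (auto simp: aut_group_def)
  then show ?thesis
    using subgroup.m_closed[OF subgroup assms] by (simp add: aut_group_def BijGroup_def)
qed

lemma G_one: "(\<lambda>x\<in>V. x) \<in> G"
  using subgroup.one_closed[OF subgroup] by (simp add: aut_group_def BijGroup_def)

lemma G_transitive: "\<lbrakk>u \<in> V; v \<in> V\<rbrakk> \<Longrightarrow> \<exists>g\<in>G. g u = v"
  using transitive_action.unique_orbit[OF transitive[unfolded vertex_transitive_def]] by simp

lemma G_inverse:
  assumes "g \<in> G"
  shows "\<exists>k\<in>G. \<forall>x\<in>V. k (g x) = x"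
proof -
  interpret A: transitive_action "aut_group \<Gamma>\<lparr>carrier := G\<rparr>" V "\<lambda>g. g"
    using transitive by (simp add: vertex_transitive_def)
  interpret A: group "aut_group \<Gamma>\<lparr>carrier := G\<rparr>"
    using A.group_hom group_hom.axioms(1) by blast
  have "inv\<^bsub>aut_group \<Gamma>\<lparr>carrier := G\<rparr>\<^esub> g \<in> G"
    using A.inv_closed[of g] assms by simp
  moreover have "(inv\<^bsub>aut_group \<Gamma>\<lparr>carrier := G\<rparr>\<^esub> g) (g x) = x" if "x \<in> V" for x
    using A.orbit_sym_aux[of g x] assms that by simp
  ultimately show ?thesis by blast
qed

text \<open>Elements of \<open>G\<close> are extensional on \<open>V\<close>, which the power
  \<open>g ^^ n\<close> need not be (\<open>g ^^ 0\<close> is the identity everywhere); so a power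
  is represented by an element of \<open>G\<close> agreeing with it on \<open>V\<close>.\<close>

lemma G_funpow:
  assumes "g \<in> G"
  shows "\<exists>k\<in>G. \<forall>x\<in>V. k x = (g ^^ n) x"
proof (induction n)
  case 0
  show ?case by (rule bexI[OF _ G_one]) simp
next
  case (Suc n)
  then obtain k where "k \<in> G" "\<forall>x\<in>V. k x = (g ^^ n) x" by blast
  then show ?case
    using G_compose[OF assms] by (intro bexI[of _ "compose V g k"]) (auto simp: compose_eq)
qed

lemma stabilizer_iff: "g \<in> vertex_stabilizer \<Gamma> G v \<longleftrightarrow> g \<in> G \<and> g v = v"
  by (simp add: vertex_stabilizer_def stabilizer_def)

lemma nbrs_image:
  assumes "g \<in> G" "v \<in> V"
  shows "N (g v) = g ` N v"
proof (intro Set.set_eqI iffI)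
  fix w assume w: "w \<in> N (g v)"
  then obtain x where "x \<in> V" "w = g x"
    using G_bij[OF assms(1)] by (metis bij_betw_imp_surj_on imageE nbrs_iff in_arcsD2)
  then show "w \<in> g ` N v"
    using w assms by (auto simp: nbrs_iff G_adj)
next
  fix w assume "w \<in> g ` N v"
  then show "w \<in> N (g v)"
    using assms by (auto simp: nbrs_iff G_adj in_arcsD2)
qed

section \<open>The local action and the partner of a vertex\<close>

lemma local_structure:
  assumes v: "v \<in> V"
  obtains w a b g where "N v = {w, a, b}" "distinct [w, a, b]"
    "\<forall>h\<in>G. h v = v \<longrightarrow> h w = w" "g \<in> G" "g v = v" "g a = b" "g b = a"
proof -
  obtain \<beta> \<phi> where \<beta>: "bij_betw \<beta> (N v) {0, 1, 2::nat}"
    and iso: "\<phi> \<in> iso (BijGroup (N v) \<lparr>carrier := local_group \<Gamma> G v\<rparr>)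
                     (BijGroup {0, 1, 2} \<lparr>carrier := Z2_on_3\<rparr>)"
    and eq: "\<forall>h \<in> local_group \<Gamma> G v. \<forall>a \<in> N v. \<beta> (h a) = \<phi> h (\<beta> a)"
    using locally v unfolding locally_Z2_3_def perm_isomorphic_def by blast
  have \<phi>: "\<phi> ` local_group \<Gamma> G v = Z2_on_3"
    using iso by (simp add: iso_def bij_betw_def)
  have inj: "\<And>x y. \<lbrakk>x \<in> N v; y \<in> N v; \<beta> x = \<beta> y\<rbrakk> \<Longrightarrow> x = y" and im: "\<beta> ` N v = {0, 1, 2}"
    using \<beta> by (auto simp: bij_betw_def inj_on_def)
  have "0 \<in> \<beta> ` N v" "1 \<in> \<beta> ` N v" "2 \<in> \<beta> ` N v" using im by auto
  then obtain a b w where ab: "a \<in> N v" "\<beta> a = 0" "b \<in> N v" "\<beta> b = 1" "w \<in> N v" "\<beta> w = 2"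
    by (metis imageE)
  \<comment> \<open>The labels 0, 1, 2 are pulled back along \<open>\<beta>\<close>: both elements
    of \<open>Z2_on_3\<close> fix the label 2 of \<open>w\<close>, and the transposition swaps the
    labels of \<open>a\<close> and \<open>b\<close>.\<close>
  have N: "N v = {w, a, b}"
  proof
    show "N v \<subseteq> {w, a, b}"
      using ab inj im by (metis empty_iff imageI insert_iff subsetI)
  qed (use ab in auto)
  have stab: "h x \<in> N v" if "h \<in> G" "h v = v" "x \<in> N v" for h x
    using nbrs_image[OF that(1) v] that by auto
  have restr: "restrict h (N v) \<in> local_group \<Gamma> G v" if "h \<in> G" "h v = v" for h
    using that by (auto simp: local_group_def stabilizer_iff)
  have fixed: "\<forall>h\<in>G. h v = v \<longrightarrow> h w = w"
  proof (intro ballI impI)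
    fix h assume h: "h \<in> G" "h v = v"
    then have "\<phi> (restrict h (N v)) \<in> Z2_on_3" using restr \<phi> by blast
    then have "\<phi> (restrict h (N v)) 2 = 2" by (auto simp: Z2_on_3_def transpose_def)
    then have "\<beta> (h w) = \<beta> w" using eq restr[OF h] ab by fastforce
    then show "h w = w" using inj stab h ab by blast
  qed
  have "(\<lambda>i \<in> {0, 1, 2}. transpose 0 1 i) \<in> \<phi> ` local_group \<Gamma> G v"
    unfolding \<phi> by (simp add: Z2_on_3_def)
  then obtain g where g: "g \<in> G" "g v = v"
    and sw: "\<phi> (restrict g (N v)) = (\<lambda>i \<in> {0, 1, 2}. transpose 0 1 i)"
    by (auto simp: local_group_def stabilizer_iff)
  have "\<beta> (g a) = \<beta> b" "\<beta> (g b) = \<beta> a"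
    using eq[rule_format, OF restr[OF g]] ab sw by auto
  then have "g a = b" "g b = a" using inj stab g ab by blast+
  moreover have "distinct [w, a, b]" using ab by auto
  ultimately show ?thesis using that N fixed g by blast
qed

text \<open>An element swapping the two remaining neighbours leaves only one candidate for a
  neighbour fixed by the whole stabilizer, so the description in \<open>partner\<close> is well
  defined.\<close>

lemma partner_eqI:
  assumes v: "v \<in> V" and w: "w \<in> N v" "\<And>g. \<lbrakk>g \<in> G; g v = v\<rbrakk> \<Longrightarrow> g w = w"
  shows "p v = w"
proof -
  obtain x a b g where x: "N v = {x, a, b}" "distinct [x, a, b]"
    "\<forall>h\<in>G. h v = v \<longrightarrow> h x = x" "g \<in> G" "g v = v" "g a = b" "g b = a"
    by (rule local_structure[OF v])
  have unique: "y = x" if "y \<in> N v" "\<forall>g\<in>vertex_stabilizer \<Gamma> G v. g y = y" for y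
  proof -
    have "g y = y" using that(2) x(4,5) by (simp add: stabilizer_iff)
    then show ?thesis using that(1) x(1,2,6,7) by auto
  qed
  have fixed: "\<forall>g\<in>vertex_stabilizer \<Gamma> G v. g w = w"
    using w(2) by (simp add: stabilizer_iff)
  show ?thesis
    unfolding partner_def
  proof (rule the_equality)
    fix y assume "y \<in> N v \<and> (\<forall>g\<in>vertex_stabilizer \<Gamma> G v. g y = y)"
    then show "y = w" using unique w(1) fixed by metis
  qed (use w(1) fixed in blast)
qed

lemma partner_structure:
  assumes v: "v \<in> V"
  obtains a b g where "N v = {p v, a, b}" "distinct [p v, a, b]"
    "g \<in> G" "g v = v" "g a = b" "g b = a"
proof -
  obtain w a b g where "N v = {w, a, b}" "distinct [w, a, b]"
    "\<forall>h\<in>G. h v = v \<longrightarrow> h w = w" "g \<in> G" "g v = v" "g a = b" "g b = a"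
    by (rule local_structure[OF v])
  moreover from this have "p v = w" using v by (intro partner_eqI) auto
  ultimately show ?thesis using that by blast
qed

lemma partner_fixed: "\<lbrakk>v \<in> V; g \<in> G; g v = v\<rbrakk> \<Longrightarrow> g (p v) = p v"
  by (metis local_structure partner_eqI insertI1)

lemma partner_adj: "v \<in> V \<Longrightarrow> (v, p v) \<in> E"
  by (metis insertI1 nbrs_iff partner_structure)

lemma partner_closed: "v \<in> V \<Longrightarrow> p v \<in> V"
  using partner_adj in_arcsD2 by blast

lemma partner_neq: "v \<in> V \<Longrightarrow> p v \<noteq> v"
  using partner_adj arc_irrefl by metis

text \<open>The stabilizer of \<open>g v\<close> is the conjugate by \<open>g\<close> of the
  stabilizer of \<open>v\<close>, which fixes \<open>p v\<close>.\<close>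

lemma partner_equivariant:
  assumes g: "g \<in> G" and v: "v \<in> V"
  shows "p (g v) = g (p v)"
proof (rule partner_eqI)
  show "g v \<in> V" "g (p v) \<in> N (g v)"
    using g v partner_adj by (auto simp: G_closed G_adj nbrs_iff partner_closed)
  fix h assume h: "h \<in> G" "h (g v) = g v"
  obtain k where k: "k \<in> G" "\<forall>x\<in>V. k (g x) = x" using G_inverse[OF g] by blast
  \<comment> \<open>With \<open>k\<close> acting as the inverse of \<open>g\<close>, this is the
    conjugate of \<open>h\<close> that fixes \<open>v\<close>.\<close>
  let ?c = "compose V k (compose V h g)"
  have "?c \<in> G" "?c v = v"
    using g h k v by (auto simp: compose_eq intro: G_compose)
  then have "?c (p v) = p v" using v by (rule_tac partner_fixed)
  then have "k (h (g (p v))) = k (g (p v))"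
    using v k by (simp add: compose_eq partner_closed)
  then show "h (g (p v)) = g (p v)"
    using G_inj[OF k(1)] g h(1) v by (simp add: G_closed partner_closed)
qed

text \<open>By equivariance and transitivity \<open>p\<close> is surjective on \<open>V\<close>;
  finiteness then gives injectivity.\<close>

lemma partner_inj: "inj_on p V"
proof (rule eq_card_imp_inj_on)
  have "V \<subseteq> p ` V"
  proof
    fix x assume x: "x \<in> V"
    then obtain g where "g \<in> G" "g (p x) = x"
      using G_transitive partner_closed by metis
    then show "x \<in> p ` V" using x by (metis partner_equivariant G_closed imageI)
  qed
  then have "p ` V = V" using partner_closed by auto
  then show "card (p ` V) = card V" by simp
qed (rule pair_finite_verts)

text \<open>Otherwise some element of the stabilizer of \<open>p v\<close> would move \<open>v\<close> to another vertex with
  partner \<open>p v\<close>.\<close>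

lemma partner_involution:
  assumes v: "v \<in> V"
  shows "p (p v) = v"
proof (rule partner_eqI)
  show "p v \<in> V" "v \<in> N (p v)"
    using v partner_adj by (auto simp: partner_closed nbrs_iff arc_sym)
  fix g assume "g \<in> G" "g (p v) = p v"
  then have "p (g v) = p v" using v by (simp add: partner_equivariant)
  then show "g v = v" using partner_inj v \<open>g \<in> G\<close> by (simp add: G_closed inj_on_eq_iff)
qed

lemma partner_eq_swap: "\<lbrakk>u \<in> V; v \<in> V\<rbrakk> \<Longrightarrow> p u = v \<longleftrightarrow> p v = u"
  using partner_involution by blast

section \<open>The non-matching arcs and their components\<close>

definition R :: "'a rel" where
  "R = {(u, v) \<in> E. v \<noteq> p u}"

lemma R_verts: "(u, v) \<in> R \<Longrightarrow> u \<in> V \<and> v \<in> V"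
  by (auto simp: R_def in_arcsD1 in_arcsD2)

text \<open>Since \<open>p\<close> is an involution, an arc and its reverse are matching arcs
  together; hence \<open>R\<^sup>*\<close> is an equivalence relation.\<close>

lemma R_sym: "(u, v) \<in> R \<Longrightarrow> (v, u) \<in> R"
  unfolding R_def using arc_sym partner_eq_swap in_arcsD1 in_arcsD2
  by (metis (mono_tags, lifting) case_prodD case_prodI mem_Collect_eq)

lemma R_rtrancl_sym: "(u, x) \<in> R\<^sup>* \<Longrightarrow> (x, u) \<in> R\<^sup>*"
  using R_sym by (meson symI sym_rtrancl symD)

lemma edge_set_iff: "{u, v} \<in> edge_set \<Gamma> \<longleftrightarrow> (u, v) \<in> E"
  using arc_sym by (fastforce simp: edge_set_def doubleton_eq_iff)

lemma R_edges_iff: "{u, v} \<in> R_edges \<Gamma> G \<longleftrightarrow> (u, v) \<in> R"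
  using partner_involution
  by (auto simp: R_edges_def T_edges_def edge_set_iff R_def doubleton_eq_iff in_arcsD1 in_arcsD2)

lemma R_edges_eq: "R_edges \<Gamma> G = {{u, v} |u v. (u, v) \<in> R}"
proof -
  have "\<exists>u v. e = {u, v}" if "e \<in> R_edges \<Gamma> G" for e
    using that by (auto simp: R_edges_def edge_set_def)
  then show ?thesis using R_edges_iff by blast
qed

text \<open>Guarantees that the subgraph induced by the \<open>R\<close>-edges loses no vertex and
  that each vertex lies on an \<open>R\<close>-cycle.\<close>

lemma R_neighbour:
  assumes "u \<in> V"
  shows "\<exists>v. (u, v) \<in> R"
proof -
  obtain a b where ab: "N u = {p u, a, b}" "distinct [p u, a, b]"
    using partner_structure[OF assms] by metis
  then have "a \<in> N u" by simp
  then have "(u, a) \<in> R" using ab(2) by (auto simp: R_def nbrs_iff)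
  then show ?thesis by blast
qed

lemma edge_induced_R: "edge_induced (R_edges \<Gamma> G) = \<lparr>pverts = V, parcs = R\<rparr>"
proof -
  have "\<Union> (R_edges \<Gamma> G) = V"
  proof
    show "\<Union> (R_edges \<Gamma> G) \<subseteq> V" using R_verts by (auto simp: R_edges_eq)
    show "V \<subseteq> \<Union> (R_edges \<Gamma> G)"
    proof
      fix u assume "u \<in> V"
      then obtain v where "(u, v) \<in> R" using R_neighbour by blast
      then have "{u, v} \<in> R_edges \<Gamma> G" by (simp add: R_edges_iff)
      then show "u \<in> \<Union> (R_edges \<Gamma> G)" by blast
    qed
  qed
  then show ?thesis by (simp add: edge_induced_def R_edges_iff)
qed

text \<open>The edge set of the component of \<open>u\<close>. Reachability is asked of one end
  only, because the step to \<open>y\<close> reaches the other.\<close>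

definition R_cycle :: "'a \<Rightarrow> 'a set set" where
  "R_cycle u = {{x, y} |x y. (x, y) \<in> R \<and> (u, x) \<in> R\<^sup>*}"

text \<open>As \<open>R\<close> is symmetric, mutual reachability is reachability, so the strong
  component of \<open>u\<close> is its \<open>R\<^sup>*\<close>-class.\<close>

lemma R_cycles_eq: "R_cycles \<Gamma> G = R_cycle ` V"
proof -
  let ?D = "edge_induced (R_edges \<Gamma> G)"
  have D: "pverts ?D = V" "parcs ?D = R" by (auto simp: edge_induced_R)
  interpret D: pair_wf_digraph ?D
    by unfold_locales (auto simp: D dest: R_verts)
  have closed: "x \<in> V" if "(u, x) \<in> R\<^sup>*" "u \<in> V" for u x
    using that by (induction rule: rtrancl_induct) (auto dest: R_verts)
  have reach: "reachable ?D u x \<longleftrightarrow> (u, x) \<in> R\<^sup>*" if "u \<in> V" for u x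
    using that closed by (auto simp add: D.reachable_conv D)
  have "edge_set (induce_subgraph ?D (D.scc_of u)) = R_cycle u" if u: "u \<in> V" for u
  proof -
    have "D.scc_of u = {x. (u, x) \<in> R\<^sup>*}"
      using u reach R_rtrancl_sym closed by (auto simp: D.scc_of_def)
    then show ?thesis
      by (force simp: edge_set_def induce_subgraph_def R_cycle_def D)
  qed
  then have "edge_set ` D.sccs = R_cycle ` V"
    unfolding D.sccs_conv_sccs_verts D.sccs_verts_conv_scc_of by (simp add: image_image D)
  then show ?thesis by (simp add: R_cycles_def)
qed

section \<open>Rotating an \<open>R\<close>-cycle by an element of \<open>G\<close>\<close>

text \<open>Some \<open>g\<close> in \<open>G\<close> takes \<open>u\<close> to \<open>v\<close>.
  Either it already moves the arc forward, or it reverses the edge; in the latter case it is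
  followed by an element fixing \<open>v\<close> and swapping the two \<open>R\<close>-neighbours of
  \<open>v\<close>.\<close>

lemma rotation:
  assumes "(u, v) \<in> R"
  obtains h where "h \<in> G" "h u = v" "N v = {p v, u, h v}"
proof -
  have uv: "u \<in> V" "v \<in> V" "(u, v) \<in> E" "v \<noteq> p u" "u \<noteq> p v"
    using assms R_sym[OF assms] R_verts by (auto simp: R_def)
  obtain g where g: "g \<in> G" "g u = v" using G_transitive uv by blast
  obtain a b s where s: "N v = {p v, a, b}" "distinct [p v, a, b]"
    "s \<in> G" "s v = v" "s a = b" "s b = a"
    by (rule partner_structure[OF uv(2)])
  have "u \<in> N v" using uv arc_sym by (simp add: nbrs_iff)
  then have u: "u = a \<or> u = b" using s uv by auto
  have "g v \<in> N v" using g uv by (metis G_adj nbrs_iff)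
  \<comment> \<open>Since \<open>p v = g (p u)\<close>, equality would force
    \<open>v = p u\<close>.\<close>
  moreover have "g v \<noteq> p v"
    using g uv partner_equivariant[OF g(1) uv(1)] by (simp add: G_inj partner_closed)
  ultimately consider "g v = u" | "N v = {p v, u, g v}" using s u by auto
  then show ?thesis
  proof cases
    case 1
    have "N v = {p v, u, s u}" using u s(1,5,6) by (metis insert_commute)
    then show ?thesis
      using that[of "compose V s g"] 1 G_compose[OF s(3) g(1)] s(4) g(2) uv(1,2)
      by (simp add: compose_eq)
  qed (use that g in blast)
qed

text \<open>The power \<open>h ^^ n\<close> carries the neighbourhood of \<open>v\<close> to that of
  \<open>(h ^^ n) v\<close>, whose \<open>R\<close>-neighbours are therefore the previous and the
  next point of the orbit. So the orbit of \<open>u\<close> is closed under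
  \<open>R\<close>-steps.\<close>

lemma R_component_orbit:
  assumes "h \<in> G" "h u = v" "N v = {p v, u, h v}" "u \<in> V" "(u, x) \<in> R\<^sup>*"
  shows "\<exists>n. x = (h ^^ n) u"
proof -
  let ?O = "range (\<lambda>n. (h ^^ n) u)"
  have O_sub: "?O \<subseteq> V"
    using G_funpow[OF assms(1)] assms(4) G_closed by (metis image_subsetI)
  have "h ` ?O \<subseteq> ?O"
    by (auto simp: image_iff) (metis comp_apply funpow.simps(2))
  moreover have "inj_on h ?O" "finite ?O"
    using O_sub G_bij[OF assms(1)] pair_finite_verts
    by (meson bij_betw_imp_inj_on inj_on_subset, meson finite_subset)
  \<comment> \<open>By finiteness every orbit point, \<open>u\<close> included, has a predecessor in
    the orbit and so equals some \<open>(h ^^ n) v\<close>. This matters because the hypothesis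
    describes the neighbourhood of \<open>v\<close>, not of \<open>u\<close>.\<close>
  ultimately have O_im: "h ` ?O = ?O" by (simp add: endo_inj_surj)
  have step: "y \<in> ?O" if "x \<in> ?O" "(x, y) \<in> R" for x y
  proof -
    have "x \<in> h ` ?O" using O_im that(1) by simp
    then obtain n where n: "x = h ((h ^^ n) u)" by blast
    obtain k where k: "k \<in> G" "\<forall>x\<in>V. k x = (h ^^ n) x" using G_funpow assms(1) by blast
    have v: "v \<in> V" and hv: "h v \<in> V" using G_closed[OF assms(1)] assms(2,4) by auto
    have x: "x = k v" unfolding n using k(2) v assms(2) by (simp add: funpow_swap1)
    have "N x = {k (p v), k u, k (h v)}"
      by (simp only: x nbrs_image[OF k(1) v] assms(3) image_insert image_empty)
    moreover have "k (p v) = p x" by (simp only: x partner_equivariant[OF k(1) v])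
    moreover have "y \<in> N x" "y \<noteq> p x" using that(2) by (auto simp: R_def nbrs_iff)
    ultimately have "y = k u \<or> y = k (h v)" by auto
    then have "y = (h ^^ n) u \<or> y = (h ^^ n) (h (h u))"
      using k(2) assms(4) hv by (simp add: assms(2))
    moreover have "(h ^^ n) (h (h u)) = (h ^^ (n + 2)) u" by (simp add: funpow_swap1)
    ultimately show ?thesis by blast
  qed
  have "x \<in> ?O"
    using assms(5)
  proof (induction rule: rtrancl_induct)
    case base
    show ?case by (rule range_eqI[of _ _ 0]) simp
  qed (rule step)
  then show ?thesis by blast
qed

end

section \<open>Consequences of non-degeneracy\<close>

locale nondegenerate_locally_Z2_3_pair = locally_Z2_3_pair +
  assumes nondegenerate: "\<not> degenerate \<Gamma> G"
begin

abbreviation "T u \<equiv> {u, p u}"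

lemma unique_edge_between:
  assumes "(u, v) \<in> E" "(x, y) \<in> E" "T u = T x" "T v = T y"
  shows "{u, v} = {x, y}"
proof (rule ccontr)
  assume ne: "{u, v} \<noteq> {x, y}"
  let ?S = "{e \<in> edge_set \<Gamma>. \<exists>a\<in>T u. \<exists>b\<in>T v. e = {a, b}}"
  \<comment> \<open>Finiteness is required because \<open>card\<close> of an infinite set is
    0.\<close>
  have "edge_set \<Gamma> = (\<lambda>a. {fst a, snd a}) ` E"
    by (simp only: edge_set_def with_proj_simps Setcompr_eq_image)
  then have "finite ?S" using pair_finite_arcs by simp
  moreover have "x \<in> T u" "y \<in> T v" using assms(3,4) by blast+
  then have "{{u, v}, {x, y}} \<subseteq> ?S"
    using assms(1,2) by (auto simp: edge_set_iff)
  ultimately have "card {{u, v}, {x, y}} \<le> card ?S" by (rule card_mono)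
  then have "card ?S > 1" using ne by simp
  moreover have "T u \<in> T_edges \<Gamma> G" "T v \<in> T_edges \<Gamma> G"
    using assms(1) in_arcsD1 in_arcsD2 by (auto simp: T_edges_def)
  ultimately show False using nondegenerate unfolding degenerate_def by blast
qed

lemma partner_not_R_connected:
  assumes u: "u \<in> V"
  shows "(u, p u) \<notin> R\<^sup>*"
proof
  assume reach: "(u, p u) \<in> R\<^sup>*"
  obtain v where uv: "(u, v) \<in> R" using R_neighbour[OF u] by blast
  then have v: "v \<in> V" "(u, v) \<in> E" "v \<noteq> p u" by (auto simp: R_def R_verts dest: in_arcsD2)
  obtain h where h: "h \<in> G" "h u = v" "N v = {p v, u, h v}" by (rule rotation[OF uv])
  obtain n where n: "p u = (h ^^ n) u" using R_component_orbit[OF h u reach] by blast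
  obtain k where k: "k \<in> G" "\<forall>x\<in>V. k x = (h ^^ n) x" using G_funpow h(1) by blast
  have "p v = h (p u)" using partner_equivariant[OF h(1) u] h(2) by simp
  \<comment> \<open>\<open>h\<close> commutes with its powers; thus \<open>k\<close> maps the arc
    \<open>(u, v)\<close> to \<open>(p u, p v)\<close>.\<close>
  also have "\<dots> = k v" using n k v(1) h(2) by (metis funpow_swap1)
  finally have arc: "(p u, p v) \<in> E"
    using n k u v by (metis G_adj)
  have "T x = T (p x)" if "x \<in> V" for x
    using partner_involution[OF that] by auto
  then have "{u, v} = {p u, p v}"
    using unique_edge_between[OF v(2) arc] u v(1) by blast
  then show False using partner_neq[OF u] v(3) by (metis doubleton_eq_iff)
qed

lemma T_eq_iff: "\<lbrakk>u \<in> V; v \<in> V\<rbrakk> \<Longrightarrow> T u = T v \<longleftrightarrow> v = u \<or> v = p u"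
  by (auto simp: doubleton_eq_iff partner_involution)

lemma iota_pair: "iota \<Gamma> G {x, y} = {T x, T y}"
  by (simp add: iota_def)

text \<open>Edges with equal images join the same two matching edges, with their ends matched in one
  of two orders; \<open>unique_edge_between\<close> applies to either.\<close>

lemma iota_inj: "inj_on (iota \<Gamma> G) (R_edges \<Gamma> G)"
proof (rule inj_onI)
  fix e f assume "e \<in> R_edges \<Gamma> G" "f \<in> R_edges \<Gamma> G" and eq: "iota \<Gamma> G e = iota \<Gamma> G f"
  then obtain u v x y where e: "e = {u, v}" "(u, v) \<in> E" and f: "f = {x, y}" "(x, y) \<in> E"
    unfolding R_edges_eq R_def by blast
  have "T u = T x \<and> T v = T y \<or> T u = T y \<and> T v = T x"
    using eq unfolding e f iota_pair doubleton_eq_iff[of "T u"] .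
  then show "e = f"
  proof (elim disjE conjE)
    assume "T u = T x" "T v = T y"
    then show ?thesis unfolding e f by (rule unique_edge_between[OF e(2) f(2)])
  next
    assume T: "T u = T y" "T v = T x"
    have "(y, x) \<in> E" using f(2) arc_sym by blast
    then have "{u, v} = {y, x}" by (rule unique_edge_between[OF e(2) _ T])
    then show ?thesis by (simp add: e f insert_commute)
  qed
qed

lemma R_cycle_sub: "R_cycle u \<subseteq> R_edges \<Gamma> G"
  unfolding R_cycle_def R_edges_eq by blast

text \<open>An unordered edge may be listed from either end; symmetry of \<open>R\<close> and one
  further step make the two readings agree.\<close>

lemma R_cycle_mem_iff: "{x, y} \<in> R_cycle u \<longleftrightarrow> (x, y) \<in> R \<and> (u, x) \<in> R\<^sup>*"
  unfolding R_cycle_def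
  by (auto simp: doubleton_eq_iff intro: R_sym rtrancl.rtrancl_into_rtrancl)

lemma R_cycle_eq: "(u, v) \<in> R\<^sup>* \<Longrightarrow> R_cycle u = R_cycle v"
  unfolding R_cycle_def by (metis (no_types, lifting) R_rtrancl_sym rtrancl_trans)

lemma iota_R_cycle_eq_iff:
  assumes "u \<in> V"
  shows "iota \<Gamma> G ` R_cycle u = iota \<Gamma> G ` R_cycle v \<longleftrightarrow> (u, v) \<in> R\<^sup>*"
proof
  assume "iota \<Gamma> G ` R_cycle u = iota \<Gamma> G ` R_cycle v"
  then have eq: "R_cycle u = R_cycle v"
    using inj_on_image_eq_iff[OF iota_inj] R_cycle_sub by metis
  \<comment> \<open>A cycle is a set of edges, so \<open>u\<close> is located on it through an edge
    at \<open>u\<close>.\<close>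
  obtain w where "(u, w) \<in> R" using R_neighbour[OF assms] by blast
  then have "{u, w} \<in> R_cycle v" by (simp add: R_cycle_mem_iff flip: eq)
  then show "(u, v) \<in> R\<^sup>*" by (simp add: R_cycle_mem_iff R_rtrancl_sym)
qed (use R_cycle_eq in metis)

section \<open>The isomorphism onto the split graph\<close>

definition \<Phi> :: "'a \<Rightarrow> 'a set \<times> 'a set set set" where
  "\<Phi> u = (T u, iota \<Gamma> G ` R_cycle u)"

abbreviation "S \<equiv> split_graph (merge_graph \<Gamma> G) (merge_cycles \<Gamma> G)"

lemma merge_cycles_eq: "merge_cycles \<Gamma> G = (\<lambda>u. iota \<Gamma> G ` R_cycle u) ` V"
  by (auto simp: merge_cycles_def R_cycles_eq)

text \<open>Only \<open>u\<close> and \<open>p u\<close> share a matching edge, and the cycle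
  component tells them apart. Conversely, a matching edge on the image of a cycle has an end on that
  cycle.\<close>

lemma \<Phi>_bij: "bij_betw \<Phi> V (pverts S)"
proof -
  have "inj_on \<Phi> V"
  proof (rule inj_onI)
    fix u v assume uv: "u \<in> V" "v \<in> V" "\<Phi> u = \<Phi> v"
    then have "v = u \<or> v = p u" "(u, v) \<in> R\<^sup>*"
      unfolding \<Phi>_def prod.inject by (simp_all only: T_eq_iff iota_R_cycle_eq_iff)
    then show "u = v" using partner_not_R_connected uv by blast
  qed
  moreover have "\<Phi> ` V = split_verts (merge_graph \<Gamma> G) (merge_cycles \<Gamma> G)"
  proof (intro Set.set_eqI iffI)
    fix x assume "x \<in> \<Phi> ` V"
    then obtain u where u: "u \<in> V" "x = \<Phi> u" by blast
    obtain w where "(u, w) \<in> R" using R_neighbour[OF u(1)] by blast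
    then have "{T u, T w} \<in> iota \<Gamma> G ` R_cycle u"
      by (intro image_eqI[of _ _ "{u, w}"]) (simp_all add: iota_pair R_cycle_mem_iff)
    then have "T u \<in> \<Union> (iota \<Gamma> G ` R_cycle u)" by blast
    then show "x \<in> split_verts (merge_graph \<Gamma> G) (merge_cycles \<Gamma> G)"
      using u by (auto simp: split_verts_def merge_graph_def T_edges_def merge_cycles_eq \<Phi>_def)
  next
    fix x assume "x \<in> split_verts (merge_graph \<Gamma> G) (merge_cycles \<Gamma> G)"
    then obtain t u e where x: "x = (t, iota \<Gamma> G ` R_cycle u)" and "u \<in> V"
      and e: "e \<in> R_cycle u" "t \<in> iota \<Gamma> G e"
      by (auto simp: split_verts_def merge_cycles_eq)
    \<comment> \<open>The preimage is this end \<open>a\<close>, not the representative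
      \<open>u\<close> of the cycle; both have the same \<open>R_cycle\<close>.\<close>
    then obtain a where a: "a \<in> e" "t = T a" by (auto simp: iota_def)
    then obtain b where "e = {a, b}" "(a, b) \<in> R"
      using e(1) R_sym unfolding R_cycle_def by blast
    then have "(u, a) \<in> R\<^sup>*" "a \<in> V" using e R_verts by (auto simp: R_cycle_mem_iff)
    then show "x \<in> \<Phi> ` V"
      using x a R_cycle_eq by (auto simp: \<Phi>_def)
  qed
  ultimately show ?thesis by (simp add: bij_betw_def split_graph_def)
qed

text \<open>The edge behind \<open>{T u, T v}\<close> might a priori end at partners of
  \<open>u\<close> or \<open>v\<close>, but partners lie on different cycles, so on one cycle a
  vertex is determined by its matching edge.\<close>

lemma R_iff_iota_mem:
  assumes "u \<in> V" "v \<in> V" "(u, v) \<in> R\<^sup>*"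
  shows "{T u, T v} \<in> iota \<Gamma> G ` R_cycle u \<longleftrightarrow> (u, v) \<in> R"
proof
  assume "(u, v) \<in> R"
  then show "{T u, T v} \<in> iota \<Gamma> G ` R_cycle u"
    by (intro image_eqI[of _ _ "{u, v}"]) (simp_all add: iota_pair R_cycle_mem_iff)
next
  assume "{T u, T v} \<in> iota \<Gamma> G ` R_cycle u"
  then obtain x y where xy: "(x, y) \<in> R" "(u, x) \<in> R\<^sup>*" and eq: "{T u, T v} = {T x, T y}"
    unfolding R_cycle_def by (auto simp: iota_pair)
  have same: "a = b" if "a \<in> V" "b \<in> V" "T a = T b" "(a, b) \<in> R\<^sup>*" for a b
    using that T_eq_iff partner_not_R_connected by metis
  have V: "x \<in> V" "y \<in> V" using R_verts xy by auto
  have uy: "(u, y) \<in> R\<^sup>*" using xy by simp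
  have vxy: "(v, x) \<in> R\<^sup>*" "(v, y) \<in> R\<^sup>*"
    using R_rtrancl_sym[OF assms(3)] xy(2) uy by (auto intro: rtrancl_trans)
  have "T u = T x \<and> T v = T y \<or> T u = T y \<and> T v = T x"
    using eq unfolding doubleton_eq_iff[of "T u"] .
  then show "(u, v) \<in> R"
  proof (elim disjE conjE)
    assume T: "T u = T x" "T v = T y"
    show ?thesis
      using same[OF assms(1) V(1) T(1) xy(2)] same[OF assms(2) V(2) T(2) vxy(2)] xy(1) by simp
  next
    assume T: "T u = T y" "T v = T x"
    show ?thesis
      using same[OF assms(1) V(2) T(1) uy] same[OF assms(2) V(1) T(2) vxy(1)] R_sym[OF xy(1)]
      by simp
  qed
qed

text \<open>Adjacency between different cycles accounts for the matching edges, adjacency within one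
  cycle for the \<open>R\<close>-edges.\<close>

lemma \<Phi>_adj:
  assumes u: "u \<in> V" and v: "v \<in> V"
  shows "(u, v) \<in> E \<longleftrightarrow> (\<Phi> u, \<Phi> v) \<in> parcs S"
proof -
  have "\<Phi> u \<in> split_verts (merge_graph \<Gamma> G) (merge_cycles \<Gamma> G)"
    "\<Phi> v \<in> split_verts (merge_graph \<Gamma> G) (merge_cycles \<Gamma> G)"
    using bij_betwE[OF \<Phi>_bij] assms by (auto simp: split_graph_def)
  then have "(\<Phi> u, \<Phi> v) \<in> parcs S \<longleftrightarrow>
    (u, v) \<notin> R\<^sup>* \<and> T u = T v \<or> (u, v) \<in> R\<^sup>* \<and> {T u, T v} \<in> iota \<Gamma> G ` R_cycle u"
    unfolding split_graph_def \<Phi>_def by (simp add: iota_R_cycle_eq_iff[OF u])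
  \<comment> \<open>The alternative \<open>v = u\<close> in \<open>T u = T v\<close> is excluded by
    reflexivity of \<open>R\<^sup>*\<close>.\<close>
  also have "\<dots> \<longleftrightarrow> v = p u \<or> (u, v) \<in> R"
    using R_iff_iota_mem[OF assms] T_eq_iff[OF assms] partner_not_R_connected[OF u] by blast
  also have "\<dots> \<longleftrightarrow> (u, v) \<in> E"
    using partner_adj[OF u] by (auto simp: R_def)
  finally show ?thesis by blast
qed

lemma split_merge_iso: "digraph_iso S \<Gamma>"
proof (rule digraph_iso_swap)
  have "pair_wf_digraph S"
    by unfold_locales (auto simp: split_graph_def)
  then show "digraph_iso \<Gamma> S"
    using \<Phi>_bij \<Phi>_adj by (intro pair_digraph_isoI pair_wf_digraph_axioms)
qed unfold_locales

end

theorem theorem4p8: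
  fixes \<Gamma> :: "'a pair_pre_digraph" and G :: "('a \<Rightarrow> 'a) set"
  assumes "pair_graph \<Gamma>"
    and "connected \<Gamma>"
    and "cubic \<Gamma>"
    and "subgroup G (aut_group \<Gamma>)"
    and "vertex_transitive \<Gamma> G"
    and "locally_Z2_3 \<Gamma> G"
    and "\<not> degenerate \<Gamma> G"
  shows "digraph_iso (split_graph (merge_graph \<Gamma> G) (merge_cycles \<Gamma> G)) \<Gamma>"
proof -
  interpret nondegenerate_locally_Z2_3_pair \<Gamma> G
    using assms
    by (intro nondegenerate_locally_Z2_3_pair.intro locally_Z2_3_pair.intro
        locally_Z2_3_pair_axioms.intro nondegenerate_locally_Z2_3_pair_axioms.intro)
  show ?thesis by (rule split_merge_iso)
qed

end
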